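(* Let $w$ be the principal's budget. Consider all schemes $\bigl(G,(x,y,z)\bigr)$, where $G$ is any joint distribution of $(A,B)$ on $[0,1]^2$ with both marginals uniform on $[0,1]$ and $(x,y,z)$ is any feasible rewarding rule. For $w\in[0,\tfrac12]$, a scheme is optimal if and only if it is either a purely sufficient scheme or a purely sustained scheme. For $w\in(\tfrac12,1]$, a scheme is optimal if and only if it is a purely sustained scheme.
   Context: Two-period principal-agent model. In each of two periods a risk-neutral agent chooses to perform ($P$) or not ($N$). Not performing costs $0$; performing costs $A$ in period 1 and $B$ in period 2. The agent knows the joint distribution $G$ of $(A,B)$, learns $A$ before the period-1 decision and $B$ only before the period-2 decision. He maximizes expected total reward minus total cost, without discounting, and performs when indifferent. A (feasible) rewarding rule with budget $w$ is a triple $(x,y,z)$ of non-negative reals with $x+z\le w$ and $y\le w$: $x$ is the reward for performing in period 1; $y$ is the reward for performing in period 2 after not performing in period 1; $z$ is the additional reward for performing in period 2 after having performed in period 1. Let $B_c$ denote a random variable whose distribution is (a version of) the conditional distribution of $B$ given $A=c$. In period 2 the agent performs iff $B\le z$ (if he performed in period 1) or $B\le y$ (if he did not). In period 1, with cost $A=c$, he performs iff $$x-c+E[(z-B_c)^+]\ \ge\ E[(y-B_c)^+].$$ A scheme is a pair $\bigl(G,(x,y,z)\bigr)$. Its performance level is the expected total number of periods in which the agent performs. A scheme is optimal if it maximizes the performance level among all schemes with budget $w$ (with $G$ ranging over all joint distributions on $[0,1]^2$ with uniform marginals). A purely sufficient scheme is a scheme with $(x,y,z)=(w,w,0)$ such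 that $P(B_c\ge w)=1$ for almost every $c\in[0,w]$. A purely sustained scheme is a scheme with $(x,y,z)=(0,0,w)$ such that $B_c=w-c$ almost surely for almost every $c\in[0,w]$ (equivalently, for a suitable version of the conditional distribution, for every $c\in[0,w]$). *)

theory Defs
  imports "HOL-Probability.Probability"
begin

(* The uniform marginals already force G to be a probability measure that is concentrated
   on the unit square. *)
definition joint_uniform :: "(real \<times> real) measure \<Rightarrow> bool" where
  "joint_uniform G \<longleftrightarrow>
     prob_space G \<and> sets G = sets (borel \<Otimes>\<^sub>M borel) \<and>
     distr G borel fst = uniform_measure lborel {0..1} \<and>
     distr G borel snd = uniform_measure lborel {0..1}"

definition is_cond_law :: "(real \<times> real) measure \<Rightarrow> (real \<Rightarrow> real measure) \<Rightarrow> bool" where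
  "is_cond_law G K \<longleftrightarrow>
     K \<in> borel \<rightarrow>\<^sub>M prob_algebra borel \<and>
     (\<forall>X\<in>sets borel. \<forall>Y\<in>sets borel.
        emeasure G (X \<times> Y) = (\<integral>\<^sup>+ c\<in>X. emeasure (K c) Y \<partial>distr G borel fst))"

(* The law of B_c: a fixed version of the conditional distribution of B given A = c. A version
   exists for every Borel probability measure on the plane, and two versions agree for almost
   every c, so no notion below depends on the choice. *)
definition cond_law :: "(real \<times> real) measure \<Rightarrow> real \<Rightarrow> real measure" where
  "cond_law G = (SOME K. is_cond_law G K)"

type_synonym rule = "real \<times> real \<times> real"

type_synonym scheme = "(real \<times> real) measure \<times> rule"

fun feasible :: "real \<Rightarrow> rule \<Rightarrow> bool" where
  "feasible w (x, y, z) \<longleftrightarrow> 0 \<le> x \<and> 0 \<le> y \<and> 0 \<le> z \<and> x + z \<le> w \<and> y \<le> w"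

fun performs1 :: "scheme \<Rightarrow> real \<Rightarrow> bool" where
  "performs1 (G, (x, y, z)) c \<longleftrightarrow>
     x - c + (\<integral>b. max 0 (z - b) \<partial>cond_law G c) \<ge> (\<integral>b. max 0 (y - b) \<partial>cond_law G c)"

fun performs2 :: "scheme \<Rightarrow> real \<Rightarrow> real \<Rightarrow> bool" where
  "performs2 (G, (x, y, z)) a b \<longleftrightarrow>
     (if performs1 (G, (x, y, z)) a then b \<le> z else b \<le> y)"

definition performance :: "scheme \<Rightarrow> real" where
  "performance s =
     (\<integral>(a, b). of_bool (performs1 s a) + of_bool (performs2 s a b) \<partial>fst s)"

definition is_scheme :: "real \<Rightarrow> scheme \<Rightarrow> bool" where
  "is_scheme w s \<longleftrightarrow> joint_uniform (fst s) \<and> feasible w (snd s)"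

definition optimal :: "real \<Rightarrow> scheme \<Rightarrow> bool" where
  "optimal w s \<longleftrightarrow> is_scheme w s \<and> (\<forall>t. is_scheme w t \<longrightarrow> performance t \<le> performance s)"

definition purely_sufficient :: "real \<Rightarrow> scheme \<Rightarrow> bool" where
  "purely_sufficient w s \<longleftrightarrow>
     is_scheme w s \<and> snd s = (w, w, 0) \<and>
     (AE c in lborel. c \<in> {0..w} \<longrightarrow> measure (cond_law (fst s) c) {w..} = 1)"

definition purely_sustained :: "real \<Rightarrow> scheme \<Rightarrow> bool" where
  "purely_sustained w s \<longleftrightarrow>
     is_scheme w s \<and> snd s = (0, 0, w) \<and>
     (AE c in lborel. c \<in> {0..w} \<longrightarrow> (AE b in cond_law (fst s) c. b = w - c))"

end

theory Submission
  imports Defs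
begin

text \<open>
  Let \<open>S\<close> be the set of period-1 costs at which the agent performs, and write \<open>(t - b)\<^sup>+\<close> for
  \<open>max 0 (t - b)\<close>. Having the period-2 reward \<open>z\<close> instead of \<open>y\<close> raises the expected surplus of
  the agent by at most \<open>(z - y)\<^sup>+\<close>, so he performs in period 1 only at costs \<open>c \<le> x + (z - y)\<^sup>+\<close>; and
  whatever he did in period 1, he performs in period 2 only at costs \<open>b \<le> max y z\<close>. As both
  marginals are uniform, the performance level is at most
  \<open>P (A \<in> S) + max y z \<le> x + (z - y)\<^sup>+ + max y z \<le> 2 * w\<close>.

  Equality in the last step leaves just the rules \<open>(0, 0, w)\<close> and \<open>(w, w, 0)\<close>, and equality in the
  others says that \<open>S\<close> is \<open>{0..w}\<close> up to null sets and that a period-2 cost of at most \<open>w\<close> is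
  almost surely met by performance. For \<open>(w, w, 0)\<close> an agent who performed in period 1 gets no
  further reward, so costs at most \<open>w\<close> in both periods have probability 0: the scheme is purely
  sufficient. For \<open>(0, 0, w)\<close> performing at cost \<open>c\<close> means \<open>c \<le> E (w - B_c)\<^sup>+\<close> for almost
  every \<open>c\<close> in \<open>{0..w}\<close>. Let \<open>V = (w - B)\<^sup>+\<close>, and let \<open>T\<close> be \<open>A\<close> where \<open>A \<le> w\<close> and 0
  elsewhere. Uniformity gives \<open>E V\<^sup>2 = E T\<^sup>2\<close>, and the inequality for \<open>c\<close> gives \<open>E (T V) \<ge> E T\<^sup>2\<close>.
  Hence \<open>E (V - T)\<^sup>2 \<le> 0\<close>, so \<open>V = T\<close> almost surely, that is, \<open>B = w - A\<close> whenever
  \<open>A \<le> w\<close> (\<open>sustained_if_surplus_ge\<close>).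

  Conversely both kinds of pure scheme attain \<open>2 * w\<close>. A purely sustained one exists for every
  \<open>w \<le> 1\<close> (\<open>sustained_coupling_exists\<close>), so the maximum is always \<open>2 * w\<close>; a purely sufficient
  one needs \<open>w = P (A \<le> w) \<le> P (B \<ge> w) = 1 - w\<close>, which fails for \<open>w > 1/2\<close>.

  All of this rests on the law of \<open>B\<close> given \<open>A\<close> being a measurable kernel that reconstructs
  \<open>G\<close>; its existence (\<open>is_cond_law_exists\<close>) is the first part below.
\<close>

text \<open>
  The decision predicates are used as measurable sets of costs; unfolding them would hide this behind integrals.
\<close>

declare performs1.simps [simp del] performs2.simps [simp del]

section \<open>Conditional laws on the plane\<close>

text \<open>
  The products \<open>X \<times> {..x}\<close> form an intersection-stable generator of the product algebra, so
  agreement on them identifies \<open>G\<close> with the measure that first draws \<open>c\<close> from the first marginal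
  and then \<open>b\<close> from \<open>K c\<close>. Writing \<open>G\<close> as a bind makes the rules for integrals and null sets
  of binds available.
\<close>

lemma disintegration_if_halflines:
  fixes G :: "(real \<times> real) measure"
  assumes "prob_space G" and sets_G [measurable_cong]: "sets G = sets (borel \<Otimes>\<^sub>M borel)"
    and K [measurable]: "K \<in> borel \<rightarrow>\<^sub>M prob_algebra borel"
    and halflines: "\<And>X x. X \<in> sets borel \<Longrightarrow>
      emeasure G (X \<times> {..x}) = (\<integral>\<^sup>+ c\<in>X. emeasure (K c) {..x} \<partial>distr G borel fst)"
  shows "G = distr G borel fst \<bind> (\<lambda>c. distr (K c) (borel \<Otimes>\<^sub>M borel) (Pair c))" (is "G = ?N")
    and "is_cond_law G K"
proof -
  interpret prob_space G by fact
  let ?L = "\<lambda>c. distr (K c) (borel \<Otimes>\<^sub>M borel) (Pair c)"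
  have sets_K: "sets (K c) = sets borel" "prob_space (K c)" for c
    using measurable_space[OF K, of c] by (auto simp: space_prob_algebra)
  have fst [measurable]: "fst \<in> G \<rightarrow>\<^sub>M borel" by simp
  have mu: "distr G borel fst \<in> space (prob_algebra borel)"
    by (simp add: space_prob_algebra prob_space_distr)
  have L [measurable]: "?L \<in> borel \<rightarrow>\<^sub>M prob_algebra (borel \<Otimes>\<^sub>M borel)" by measurable
  have rect: "emeasure ?N (X \<times> Y) = (\<integral>\<^sup>+ c\<in>X. emeasure (K c) Y \<partial>distr G borel fst)"
    if [measurable]: "X \<in> sets borel" "Y \<in> sets borel" for X Y
  proof -
    have "emeasure ?N (X \<times> Y) = (\<integral>\<^sup>+ c. emeasure (?L c) (X \<times> Y) \<partial>distr G borel fst)"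
      by (rule emeasure_bind_prob_algebra[OF mu L]) simp
    also have "\<dots> = (\<integral>\<^sup>+ c\<in>X. emeasure (K c) Y \<partial>distr G borel fst)"
    proof (rule nn_integral_cong)
      fix c
      have m: "Pair c \<in> K c \<rightarrow>\<^sub>M borel \<Otimes>\<^sub>M borel"
        by (subst measurable_cong_sets[OF sets_K(1) refl]) simp
      have "Pair c -` (X \<times> Y) \<inter> space (K c) = (if c \<in> X then Y else {})"
        using sets_eq_imp_space_eq[OF sets_K(1)] by auto
      then show "emeasure (?L c) (X \<times> Y) = emeasure (K c) Y * indicator X c"
        by (subst emeasure_distr[OF m]) auto
    qed
    finally show ?thesis .
  qed
  have gen: "sets (borel \<Otimes>\<^sub>M borel) =
    sigma_sets UNIV {X \<times> Y |X Y. X \<in> sets (borel :: real measure) \<and> Y \<in> range (atMost :: real \<Rightarrow> real set)}"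
  proof -
    have "sets (borel \<Otimes>\<^sub>M borel) = sets (sigma (space borel \<times> space borel)
       {X \<times> Y |X Y. X \<in> {X :: real set. X \<in> sets borel} \<and> Y \<in> range (atMost :: real \<Rightarrow> real set)})"
    proof (rule sets_pair_eq[where Ca = "{UNIV}" and Cb = "range (\<lambda>n::nat. {..real n})"])
      show "sets borel = sigma_sets (space borel) {X :: real set. X \<in> sets borel}"
        using sets.sigma_sets_eq[of "borel::real measure"] by simp
      show "sets borel = sigma_sets (space borel) (range (atMost :: real \<Rightarrow> real set))"
        by (subst borel_eq_atMost) (auto simp: sets_measure_of)
    qed (auto intro: real_arch_simple)
    then show ?thesis by (simp add: sets_measure_of)
  qed
  show eq: "G = ?N"
  proof (rule measure_eqI_generator_eq[where \<Omega> = UNIV and A = "\<lambda>n::nat. UNIV \<times> {..real n}"])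
    show "Int_stable {X \<times> Y |X Y. X \<in> sets (borel :: real measure) \<and> Y \<in> range (atMost :: real \<Rightarrow> real set)}"
    proof (rule Int_stableI, safe)
      fix X X' :: "real set" and x x' :: real assume "X \<in> sets borel" "X' \<in> sets borel"
      then show "\<exists>Xa Y. X \<times> {..x} \<inter> X' \<times> {..x'} = Xa \<times> Y \<and> Xa \<in> sets borel \<and> Y \<in> range atMost"
        by (intro exI[of _ "X \<inter> X'"] exI[of _ "{..min x x'}"]) auto
    qed
    show "sets ?N = sigma_sets UNIV {X \<times> Y |X Y. X \<in> sets (borel :: real measure) \<and> Y \<in> range (atMost :: real \<Rightarrow> real set)}"
      by (subst sets_bind[where N = "borel \<Otimes>\<^sub>M borel"]) (auto simp: gen)
    show "emeasure G A = emeasure ?N A"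
      if "A \<in> {X \<times> Y |X Y. X \<in> sets (borel :: real measure) \<and> Y \<in> range (atMost :: real \<Rightarrow> real set)}" for A
      using that by (auto simp: halflines rect)
    show "range (\<lambda>n::nat. UNIV \<times> {..real n}) \<subseteq>
      {X \<times> Y |X Y. X \<in> sets (borel :: real measure) \<and> Y \<in> range (atMost :: real \<Rightarrow> real set)}"
    proof safe
      fix n :: nat
      show "\<exists>X Y. UNIV \<times> {..real n} = X \<times> Y \<and> X \<in> sets (borel :: real measure) \<and> Y \<in> range atMost"
        by (intro exI[of _ UNIV] exI[of _ "{..real n}"]) auto
    qed
    show "sets G = sigma_sets UNIV {X \<times> Y |X Y. X \<in> sets (borel :: real measure) \<and> Y \<in> range (atMost :: real \<Rightarrow> real set)}"
      by (simp only: sets_G gen)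
    show "(\<Union>n::nat. UNIV \<times> {..real n}) = (UNIV :: (real \<times> real) set)"
      by (auto intro: real_arch_simple)
  qed (rule subset_UNIV | simp)+
  show "is_cond_law G K"
    unfolding is_cond_law_def
  proof (intro conjI ballI)
    fix X Y :: "real set" assume "X \<in> sets borel" "Y \<in> sets borel"
    from rect[OF this] show
      "emeasure G (X \<times> Y) = (\<integral>\<^sup>+ c\<in>X. emeasure (K c) Y \<partial>distr G borel fst)"
      unfolding eq[symmetric] .
  qed (rule K)
qed

lemma is_cond_law_bind:
  assumes "prob_space G" and "sets G = sets (borel \<Otimes>\<^sub>M borel)" and "is_cond_law G K"
  shows "G = distr G borel fst \<bind> (\<lambda>c. distr (K c) (borel \<Otimes>\<^sub>M borel) (Pair c))"
  using assms(3) unfolding is_cond_law_def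
  by (intro disintegration_if_halflines(1) assms(1,2)) simp_all

text \<open>
  Conditional probabilities of \<open>B \<le> q\<close> are simultaneously well behaved for countably many \<open>q\<close>
  only. Taking the infimum over larger rationals extends them to a right-continuous function on the
  line; since \<open>h\<close> need not be right-continuous itself, the extension is related to \<open>h\<close> just
  through limits from the right, as in the last claim.
\<close>

lemma inf_over_larger_rationals_is_cdf:
  fixes h :: "real \<Rightarrow> real"
  assumes mono: "\<And>p q. p \<in> \<rat> \<Longrightarrow> q \<in> \<rat> \<Longrightarrow> p \<le> q \<Longrightarrow> h p \<le> h q"
    and bot: "(\<lambda>n. h (- real n)) \<longlonglongrightarrow> 0" and top: "(\<lambda>n. h (real n)) \<longlonglongrightarrow> 1"
  defines "F \<equiv> \<lambda>x. INF q\<in>{q\<in>\<rat>. x < q}. h q"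
  shows "x \<le> y \<Longrightarrow> F x \<le> F y"
    and "continuous (at_right x) F"
    and "(F \<longlongrightarrow> 0) at_bot"
    and "(F \<longlongrightarrow> 1) at_top"
    and "(\<And>n. r n \<in> \<rat>) \<Longrightarrow> (\<And>n. x < r n) \<Longrightarrow> r \<longlonglongrightarrow> x \<Longrightarrow> (\<lambda>n. h (r n)) \<longlonglongrightarrow> F x"
proof -
  have ne: "\<exists>q\<in>\<rat>. x < q" for x :: real
    using Rats_dense_in_real[of x "x + 1"] by auto
  have bdd: "bdd_below (h ` {q\<in>\<rat>. x < q})" for x
  proof -
    obtain n :: nat where n: "- x < real n" using reals_Archimedean2 by blast
    then have "\<And>q. q \<in> {q\<in>\<rat>. x < q} \<Longrightarrow> h (- real n) \<le> h q" by (intro mono) auto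
    then show ?thesis by (rule bdd_belowI2)
  qed
  have le: "F x \<le> h q" if "q \<in> \<rat>" "x < q" for x q
    unfolding F_def by (rule cINF_lower[OF bdd]) (use that in auto)
  have ge: "l \<le> F x" if "\<And>q. q \<in> \<rat> \<Longrightarrow> x < q \<Longrightarrow> l \<le> h q" for l x
    unfolding F_def by (rule cINF_greatest) (use that ne[of x] in auto)
  have ge_h: "h p \<le> F x" if "p \<in> \<rat>" "p \<le> x" for p x
    by (rule ge) (use that in \<open>auto intro!: mono\<close>)
  have less: "\<exists>q\<in>\<rat>. x < q \<and> h q < u" if "F x < u" for x u
    using that ge[of x u] by force
  show monoF: "x \<le> y \<Longrightarrow> F x \<le> F y" for x y
    by (rule ge) (auto intro: le)
  show "continuous (at_right x) F" unfolding continuous_within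
  proof (rule order_tendstoI)
    fix u assume "F x < u"
    then obtain q where q: "q \<in> \<rat>" "x < q" "h q < u" using less by blast
    show "\<forall>\<^sub>F y in at_right x. F y < u"
      by (rule eventually_at_rightI[OF _ q(2)]) (use q le[OF q(1)] in force)
  next
    fix l assume "l < F x"
    then show "\<forall>\<^sub>F y in at_right x. l < F y"
      by (intro eventually_at_rightI[of x "x + 1"]) (use monoF in \<open>auto intro: less_le_trans\<close>)
  qed
  have ge0: "0 \<le> F x" for x
  proof (rule LIMSEQ_le_const2[OF bot])
    obtain n :: nat where n: "- x < real n" using reals_Archimedean2 by blast
    show "\<exists>N. \<forall>n\<ge>N. h (- real n) \<le> F x"
      by (intro exI[of _ n] allI impI ge_h) (use n in auto)
  qed
  have le1: "F x \<le> 1" for x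
  proof (rule LIMSEQ_le_const[OF top])
    obtain n :: nat where n: "x < real n" using reals_Archimedean2 by blast
    show "\<exists>N. \<forall>n\<ge>N. F x \<le> h (real n)"
      by (intro exI[of _ n] allI impI le) (use n in auto)
  qed
  show "(F \<longlongrightarrow> 0) at_bot"
  proof (rule order_tendstoI)
    fix u :: real assume "0 < u"
    then obtain n where n: "h (- real n) < u"
      using order_tendstoD(2)[OF bot] by (auto simp: eventually_sequentially)
    have "F x < u" if "x < - real n" for x using le[of "- real n" x] that n by simp
    then show "\<forall>\<^sub>F x in at_bot. F x < u" 
      using eventually_gt_at_bot by (auto simp: eventually_at_bot_dense)
  qed (auto intro!: always_eventually less_le_trans[OF _ ge0])
  show "(F \<longlongrightarrow> 1) at_top"
  proof (rule order_tendstoI)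
    fix l :: real assume "l < 1"
    then obtain n where n: "l < h (real n)"
      using order_tendstoD(1)[OF top] by (auto simp: eventually_sequentially)
    have "l < F x" if "x \<ge> real n" for x using ge_h[of "real n" x] that n by simp
    then show "\<forall>\<^sub>F x in at_top. l < F x" by (auto simp: eventually_at_top_linorder)
  qed (auto intro!: always_eventually le_less_trans[OF le1])
  assume r: "\<And>n. r n \<in> \<rat>" "\<And>n. x < r n" "r \<longlonglongrightarrow> x"
  show "(\<lambda>n. h (r n)) \<longlonglongrightarrow> F x"
  proof (rule order_tendstoI)
    fix u assume "F x < u"
    then obtain q where q: "q \<in> \<rat>" "x < q" "h q < u" using less by blast
    show "\<forall>\<^sub>F n in sequentially. h (r n) < u"
      using order_tendstoD(2)[OF r(3) q(2)]
    proof eventually_elim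
      case (elim n)
      then show ?case using mono[OF r(1) q(1), of n] q(3) by simp
    qed
  next
    fix l assume "l < F x"
    then have "l < h (r n)" for n using le[OF r(1,2), of n] by simp
    then show "\<forall>\<^sub>F n in sequentially. l < h (r n)" by simp
  qed
qed

text \<open>
  The pointwise limit exists by monotonicity, is nonnegative, and has integral 0 by dominated
  convergence.
\<close>

lemma AE_tendsto_0_if_decreasing:
  fixes f :: "nat \<Rightarrow> 'a \<Rightarrow> real"
  assumes "finite_measure M" and [measurable]: "\<And>n. f n \<in> borel_measurable M"
    and bounds: "AE p in M. \<forall>n. 0 \<le> f n p \<and> f n p \<le> 1"
    and dec: "AE p in M. decseq (\<lambda>n. f n p)"
    and int: "(\<lambda>n. \<integral>p. f n p \<partial>M) \<longlonglongrightarrow> 0"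
  shows "AE p in M. (\<lambda>n. f n p) \<longlonglongrightarrow> 0"
proof -
  interpret finite_measure M by fact
  define l where "l p = lim (\<lambda>n. f n p)" for p
  have l [measurable]: "l \<in> borel_measurable M" unfolding l_def by measurable
  have lim: "AE p in M. (\<lambda>n. f n p) \<longlonglongrightarrow> l p"
    using bounds dec
  proof eventually_elim
    case (elim p)
    then have "convergent (\<lambda>n. f n p)"
      using decseq_convergent[of "\<lambda>n. f n p" 0] by (metis convergentI)
    then show ?case by (simp add: l_def convergent_LIMSEQ_iff)
  qed
  have l_bounds: "AE p in M. 0 \<le> l p \<and> l p \<le> 1"
    using lim bounds by eventually_elim (auto intro: LIMSEQ_le_const LIMSEQ_le_const2)
  have "(\<lambda>n. \<integral>p. f n p \<partial>M) \<longlonglongrightarrow> (\<integral>p. l p \<partial>M)"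
    by (rule integral_dominated_convergence[where w = "\<lambda>_. 1"]) (use lim bounds in auto)
  then have "(\<integral>p. l p \<partial>M) = 0" using int LIMSEQ_unique by blast
  moreover have "integrable M l"
    by (rule integrable_const_bound[where B = 1]) (use l_bounds in auto)
  ultimately have "AE p in M. l p = 0"
    using integral_nonneg_eq_0_iff_AE[of M l] l_bounds by auto
  then show ?thesis using lim by eventually_elim simp
qed

text \<open>
  A function measurable for the algebra generated by the first coordinate is constant on vertical
  lines, so evaluating it at second coordinate 0 turns it into a Borel function of the first
  coordinate. The value 0 is arbitrary.
\<close>

lemma conditional_expectation_given_fst:
  fixes f :: "real \<times> real \<Rightarrow> real"
  assumes "prob_space G" and sets_G [measurable_cong]: "sets G = sets (borel \<Otimes>\<^sub>M borel)"
  defines "S \<equiv> vimage_algebra UNIV fst (borel :: real measure)"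
  shows "finite_measure_subalgebra G S"
    and "real_cond_exp G S f p = real_cond_exp G S f (fst p, 0)"
    and "(\<lambda>c. real_cond_exp G S f (c, 0)) \<in> borel_measurable borel"
    and "X \<in> sets borel \<Longrightarrow> X \<times> UNIV \<in> sets S"
proof -
  interpret prob_space G by fact
  have space_G: "space G = UNIV"
    using sets_eq_imp_space_eq[OF sets_G] by (simp add: space_pair_measure)
  have S: "sets S = {fst -` A |A. A \<in> sets borel}"
    unfolding S_def by (subst sets_vimage_algebra2) auto
  show "finite_measure_subalgebra G S"
  proof
    show "subalgebra G S"
      unfolding subalgebra_def
    proof (intro conjI subsetI)
      fix A assume "A \<in> sets S"
      then obtain B where B: "A = fst -` B" "B \<in> sets borel" by (auto simp: S)
      have "fst -` B \<inter> space (borel \<Otimes>\<^sub>M borel) \<in> sets (borel \<Otimes>\<^sub>M borel :: (real \<times> real) measure)"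
        by (rule measurable_sets[OF measurable_fst B(2)])
      then show "A \<in> sets G" by (simp add: B sets_G space_pair_measure)
    qed (simp add: S_def space_G)
  qed
  have meas: "real_cond_exp G S f \<in> borel_measurable S" by measurable
  have "real_cond_exp G S f -` {real_cond_exp G S f p} \<inter> space S \<in> sets S"
    by (rule measurable_sets[OF meas]) simp
  then have "real_cond_exp G S f -` {real_cond_exp G S f p} \<in> sets S"
    by (simp add: S_def)
  then obtain A where "real_cond_exp G S f -` {real_cond_exp G S f p} = fst -` A"
    unfolding S by blast
  then show "real_cond_exp G S f p = real_cond_exp G S f (fst p, 0)"
    by (metis (mono_tags, lifting) fst_conv singletonD singletonI vimage_eq)
  have "(\<lambda>c. (c, 0 :: real)) \<in> borel \<rightarrow>\<^sub>M S"
    unfolding S_def by (rule measurable_vimage_algebra2) auto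
  from measurable_compose[OF this meas]
  show "(\<lambda>c. real_cond_exp G S f (c, 0)) \<in> borel_measurable borel" .
  show "X \<in> sets borel \<Longrightarrow> X \<times> UNIV \<in> sets S" by (auto simp: S)
qed

text \<open>
  In this form convergence of a sequence of measurable functions to a constant is visibly a
  measurable condition.
\<close>

lemma tendsto_iff_Cauchy_lim:
  fixes f :: "nat \<Rightarrow> real"
  shows "f \<longlonglongrightarrow> l \<longleftrightarrow> Cauchy f \<and> lim f = l"
  by (metis Cauchy_convergent_iff convergent_LIMSEQ_iff limI convergentI)

text \<open>
  For rational \<open>q\<close> let \<open>h q\<close> be the conditional probability of \<open>B \<le> q\<close> given \<open>A\<close>. Outside a
  null set of \<open>c\<close>, the map \<open>q \<mapsto> h q c\<close> is monotone with limits 0 and 1, so it extends to a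
  distribution function, and \<open>K c\<close> is the measure with that distribution function. That \<open>K\<close>
  disintegrates \<open>G\<close> on half-lines follows by approximating the end point by rationals from above.
\<close>

theorem is_cond_law_exists:
  fixes G :: "(real \<times> real) measure"
  assumes "prob_space G" and sets_G [measurable_cong]: "sets G = sets (borel \<Otimes>\<^sub>M borel)"
  shows "\<exists>K. is_cond_law G K"
proof -
  interpret prob_space G by fact
  define S :: "(real \<times> real) measure" where "S = vimage_algebra UNIV fst borel"
  define B where "B q = (indicator (UNIV \<times> {..q}) :: real \<times> real \<Rightarrow> real)" for q
  define h where "h q c = real_cond_exp G S (B q) (c, 0)" for q c
  note ce = conditional_expectation_given_fst[OF assms, folded S_def]
  interpret finite_measure_subalgebra G S by (rule ce)
  have h: "real_cond_exp G S (B q) p = h q (fst p)" for q p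
    unfolding h_def by (rule ce)
  have [measurable]: "h q \<in> borel_measurable borel" for q
    unfolding h_def by (rule ce)
  have [measurable]: "B q \<in> borel_measurable G" for q unfolding B_def by measurable
  have int_B [simp]: "integrable G (B q)" for q
    by (rule integrable_const_bound[where B = 1]) (auto simp: B_def)
  have space_G: "space G = UNIV"
    using sets_eq_imp_space_eq[OF sets_G] by (simp add: space_pair_measure)
  have [measurable]: "fst \<in> G \<rightarrow>\<^sub>M borel" by simp
  have int_h: "(\<integral>p. indicator X (fst p) * h q (fst p) \<partial>G) = measure G (X \<times> {..q})"
    if [measurable]: "X \<in> sets borel" for X q
  proof -
    have "measure G (X \<times> {..q}) = (\<integral>p\<in>X \<times> UNIV. B q p \<partial>G)"
    proof -
      have "(\<integral>p\<in>X \<times> UNIV. B q p \<partial>G) = (\<integral>p. indicator (X \<times> {..q}) p \<partial>G)"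
        unfolding set_lebesgue_integral_def
        by (intro Bochner_Integration.integral_cong) (auto simp: B_def indicator_def)
      then show ?thesis by (simp add: space_G)
    qed
    also have "\<dots> = (\<integral>p\<in>X \<times> UNIV. h q (fst p) \<partial>G)"
      by (subst real_cond_exp_intA) (auto simp: h ce(4) set_lebesgue_integral_def)
    finally show ?thesis
      by (auto simp: set_lebesgue_integral_def indicator_def intro!: Bochner_Integration.integral_cong)
  qed
  have mono: "AE p in G. h q (fst p) \<le> h r (fst p)" if "q \<le> r" for q r
  proof -
    have "AE p in G. B q p \<le> B r p" using that by (intro AE_I2) (auto simp: B_def indicator_def)
    from real_cond_exp_mono[OF this int_B int_B] show ?thesis unfolding h .
  qed
  have bounds: "AE p in G. 0 \<le> h q (fst p) \<and> h q (fst p) \<le> 1" for q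
  proof -
    have "AE p in G. real_cond_exp G S (B q) p \<ge> 0" by (rule real_cond_exp_pos) (auto simp: B_def)
    moreover have "AE p in G. real_cond_exp G S (B q) p \<le> 1"
      by (rule real_cond_exp_le_c[OF int_B]) (auto simp: B_def)
    ultimately show ?thesis by (auto simp: h)
  qed
  have AE_mono: "AE p in G. \<forall>q\<in>\<rat>. \<forall>r\<in>\<rat>. q \<le> r \<longrightarrow> h q (fst p) \<le> h r (fst p)"
    by (intro AE_ball_countable'[OF _ countable_rat] AE_impI mono) 
  have AE_bounds: "AE p in G. \<forall>q\<in>\<rat>. 0 \<le> h q (fst p) \<and> h q (fst p) \<le> 1"
    by (intro AE_ball_countable'[OF _ countable_rat] bounds)
  interpret D: real_distribution "distr G borel snd" by (rule real_distribution_distr) simp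
  have cdf_D: "cdf (distr G borel snd) q = (\<integral>p. h q (fst p) \<partial>G)" for q
  proof -
    have "snd -` {..q} = (UNIV :: real set) \<times> {..q}" by auto
    then show ?thesis using int_h[of UNIV q]
      by (simp add: cdf_def measure_distr space_G)
  qed
  have AE_bot: "AE p in G. (\<lambda>n. h (- real n) (fst p)) \<longlonglongrightarrow> 0"
  proof (rule AE_tendsto_0_if_decreasing)
    show "AE p in G. decseq (\<lambda>n. h (- real n) (fst p))"
      using AE_mono by eventually_elim (auto simp: decseq_def)
    show "(\<lambda>n. \<integral>p. h (- real n) (fst p) \<partial>G) \<longlonglongrightarrow> 0"
      using D.cdf_lim_neg_infty by (simp add: cdf_D)
  qed (use AE_bounds in \<open>auto intro: finite_measure_axioms\<close>)
  have AE_top: "AE p in G. (\<lambda>n. h (real n) (fst p)) \<longlonglongrightarrow> 1"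
  proof -
    have "AE p in G. (\<lambda>n. 1 - h (real n) (fst p)) \<longlonglongrightarrow> 0"
    proof (rule AE_tendsto_0_if_decreasing)
      show "AE p in G. decseq (\<lambda>n. 1 - h (real n) (fst p))"
        using AE_mono by eventually_elim (auto simp: decseq_def)
      have "integrable G (\<lambda>p. h q (fst p))" for q
        unfolding h[symmetric] by (rule real_cond_exp_int(1)[OF int_B])
      then have "(\<integral>p. 1 - h (real n) (fst p) \<partial>G) = 1 - cdf (distr G borel snd) (real n)" for n
        by (simp add: cdf_D prob_space)
      moreover have "(\<lambda>n. 1 - cdf (distr G borel snd) (real n)) \<longlonglongrightarrow> 1 - 1"
        by (intro tendsto_intros D.cdf_lim_infty_prob)
      ultimately show "(\<lambda>n. \<integral>p. 1 - h (real n) (fst p) \<partial>G) \<longlonglongrightarrow> 0" by simp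
    qed (use AE_bounds in \<open>auto intro: finite_measure_axioms\<close>)
    then show ?thesis
    proof eventually_elim
      case (elim p)
      from tendsto_diff[OF tendsto_const[of 1] this] show ?case by simp
    qed
  qed
  \<comment> \<open>The set of good c has to be Borel, because K is a case distinction on it.\<close>
  define good where "good c \<longleftrightarrow> (\<forall>q\<in>\<rat>. \<forall>r\<in>\<rat>. q \<le> r \<longrightarrow> h q c \<le> h r c) \<and>
    (\<lambda>n. h (- real n) c) \<longlonglongrightarrow> 0 \<and> (\<lambda>n. h (real n) c) \<longlonglongrightarrow> 1" for c
  have AE_good: "AE p in G. good (fst p)"
    using AE_mono AE_bot AE_top by eventually_elim (simp add: good_def)
  have [measurable]: "Measurable.pred borel (\<lambda>c. \<forall>q\<in>\<rat>. \<forall>r\<in>\<rat>. q \<le> r \<longrightarrow> h q c \<le> h r c)"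
  proof -
    have "Measurable.pred borel (\<lambda>c. \<forall>q r :: rat. (of_rat q :: real) \<le> of_rat r \<longrightarrow>
        h (of_rat q) c \<le> h (of_rat r) c)"
      by measurable
    then show ?thesis by (simp add: Rats_def)
  qed
  have [measurable]: "Measurable.pred borel (\<lambda>c. (\<lambda>n. h (a n) c) \<longlonglongrightarrow> l)" for a :: "nat \<Rightarrow> real" and l
  proof -
    have "{c \<in> space borel. Cauchy (\<lambda>n. h (a n) c)} \<in> sets borel"
      by (rule sets_Collect_Cauchy) measurable
    then have [measurable]: "Measurable.pred borel (\<lambda>c. Cauchy (\<lambda>n. h (a n) c))"
      unfolding pred_def .
    have [measurable]: "(\<lambda>c. lim (\<lambda>n. h (a n) c)) \<in> borel_measurable borel"
      by (rule borel_measurable_lim_metric) measurable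
    show ?thesis unfolding tendsto_iff_Cauchy_lim by measurable
  qed
  have [measurable]: "Measurable.pred borel good"
    unfolding good_def by measurable
  define F where "F c x = (INF q\<in>{q\<in>\<rat>. x < q}. h q c)" for c x
  define K where "K c = (if good c then interval_measure (F c) else return borel 0)" for c
  have F_cdf: "\<And>x y. x \<le> y \<Longrightarrow> F c x \<le> F c y" "\<And>x. continuous (at_right x) (F c)"
      "(F c \<longlongrightarrow> 0) at_bot" "(F c \<longlongrightarrow> 1) at_top"
      "\<And>r x. (\<And>n. r n \<in> \<rat>) \<Longrightarrow> (\<And>n. x < r n) \<Longrightarrow> r \<longlonglongrightarrow> x \<Longrightarrow> (\<lambda>n. h (r n) c) \<longlonglongrightarrow> F c x"
    if "good c" for c
    using inf_over_larger_rationals_is_cdf[of "\<lambda>q. h q c"] that unfolding good_def F_def by auto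
  have K_Iic: "measure (K c) {..x} = (if good c then F c x else indicator {..x} 0)" for c x
    by (auto simp: K_def measure_interval_measure_Iic F_cdf measure_return)
  have K_prob: "prob_space (K c)" and K_sets: "sets (K c) = sets borel" for c
    using real_distribution_interval_measure[OF F_cdf(1-4), of c]
    by (auto simp: K_def prob_space_return real_distribution_def)
  have approx: "\<exists>r. (\<forall>n. r n \<in> \<rat> \<and> x < r n) \<and> r \<longlonglongrightarrow> x" for x :: real
  proof -
    have "\<forall>n. \<exists>q\<in>\<rat>. x < q \<and> q < x + inverse (real (Suc n))"
      by (auto intro!: Rats_dense_in_real)
    then obtain r where r: "\<And>n. r n \<in> \<rat>" "\<And>n. x < r n" "\<And>n. r n < x + inverse (real (Suc n))"
      by metis
    have "r \<longlonglongrightarrow> x"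
    proof (rule tendsto_sandwich)
      show "\<forall>\<^sub>F n in sequentially. x \<le> r n" "\<forall>\<^sub>F n in sequentially. r n \<le> x + inverse (real (Suc n))"
        using r by (auto intro!: always_eventually less_imp_le simp del: of_nat_Suc)
      show "(\<lambda>n. x + inverse (real (Suc n))) \<longlonglongrightarrow> x"
        by (rule LIMSEQ_inverse_real_of_nat_add)
    qed simp
    with r show ?thesis by blast
  qed
  have F_meas [measurable]: "(\<lambda>c. if good c then F c x else indicator {..x} 0) \<in> borel_measurable borel"
    for x
  proof -
    obtain r where r: "\<And>n. r n \<in> \<rat>" "\<And>n. x < r n" "r \<longlonglongrightarrow> x" using approx by blast
    show ?thesis
    proof (rule borel_measurable_LIMSEQ_real)
      show "(\<lambda>n. if good c then h (r n) c else indicator {..x} 0) \<longlonglongrightarrow>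
          (if good c then F c x else indicator {..x} 0)" for c
        using F_cdf(5)[OF _ r] by auto
    qed measurable
  qed
  have "K \<in> borel \<rightarrow>\<^sub>M prob_algebra borel"
  proof (rule measurable_prob_algebra_generated[where \<Omega> = UNIV and G = "range atMost"])
    show "sets (borel :: real measure) = sigma_sets UNIV (range atMost)"
      by (subst borel_eq_atMost) (auto simp: sets_measure_of)
    show "Int_stable (range (atMost :: real \<Rightarrow> real set))"
    proof (rule Int_stableI, safe)
      fix a b :: real show "{..a} \<inter> {..b} \<in> range atMost" by (intro image_eqI[of _ _ "min a b"]) auto
    qed
    fix A :: "real set" assume "A \<in> range atMost"
    then obtain x where A: "A = {..x}" by auto
    show "(\<lambda>c. emeasure (K c) A) \<in> borel_measurable borel"
      unfolding A by (simp add: finite_measure.emeasure_eq_measure[OF prob_space.finite_measure[OF K_prob]] K_Iic)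
  qed (auto simp: K_prob K_sets)
  moreover have "emeasure G (X \<times> {..x}) = (\<integral>\<^sup>+ c\<in>X. emeasure (K c) {..x} \<partial>distr G borel fst)"
    if [measurable]: "X \<in> sets borel" for X x
  proof -
    obtain r where r: "\<And>n. r n \<in> \<rat>" "\<And>n. x < r n" "r \<longlonglongrightarrow> x" using approx by blast
    have "(\<lambda>n. \<integral>p. indicator X (fst p) * h (r n) (fst p) \<partial>G) \<longlonglongrightarrow>
      (\<integral>p. indicator X (fst p) * measure (K (fst p)) {..x} \<partial>G)"
    proof (rule integral_dominated_convergence[where w = "\<lambda>_. 1"])
      show "(\<lambda>p. indicator X (fst p) * measure (K (fst p)) {..x}) \<in> borel_measurable G"
        unfolding K_Iic by measurable
      show "AE p in G. (\<lambda>n. indicator X (fst p) * h (r n) (fst p)) \<longlonglongrightarrow>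
          indicator X (fst p) * measure (K (fst p)) {..x}"
        using AE_good by eventually_elim (auto simp: K_Iic intro!: tendsto_intros F_cdf(5) r)
      show "AE p in G. norm (indicator X (fst p) * h (r n) (fst p)) \<le> 1" for n
        using AE_bounds by eventually_elim (use r(1)[of n] in \<open>auto simp: indicator_def\<close>)
    qed auto
    moreover have "(\<lambda>n. measure G (X \<times> {..r n})) \<longlonglongrightarrow> measure G (X \<times> {..x})"
    proof -
      have "(\<lambda>n. \<integral>p. indicator (X \<times> {..r n}) p \<partial>G) \<longlonglongrightarrow> (\<integral>p. indicat_real (X \<times> {..x}) p \<partial>G)"
      proof (rule integral_dominated_convergence[where w = "\<lambda>_. 1"])
        have "(\<lambda>n. indicat_real (X \<times> {..r n}) p) \<longlonglongrightarrow> indicator (X \<times> {..x}) p" for p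
        proof (cases "snd p \<le> x")
          case True
          then have "snd p \<le> r n" for n using r(2)[of n] by simp
          with True show ?thesis by (cases p) (simp add: indicator_def)
        next
          case False
          then have "\<forall>\<^sub>F n in sequentially. r n < snd p"
            using order_tendstoD(2)[OF r(3)] by simp
          then show ?thesis
            by (intro tendsto_eventually, eventually_elim) (use False in \<open>auto simp: indicator_def\<close>)
        qed
        then show "AE p in G. (\<lambda>n. indicat_real (X \<times> {..r n}) p) \<longlonglongrightarrow> indicator (X \<times> {..x}) p" by simp
      qed auto
      then show ?thesis by (simp add: space_G)
    qed
    ultimately have "measure G (X \<times> {..x}) = (\<integral>p. indicator X (fst p) * measure (K (fst p)) {..x} \<partial>G)"
      unfolding int_h[OF that] using LIMSEQ_unique by blast
    also have "ennreal \<dots> = (\<integral>\<^sup>+p. ennreal (indicator X (fst p) * measure (K (fst p)) {..x}) \<partial>G)"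
    proof (rule nn_integral_eq_integral[symmetric])
      show "integrable G (\<lambda>p. indicator X (fst p) * measure (K (fst p)) {..x})"
        using prob_space.prob_le_1[OF K_prob]
        by (intro integrable_const_bound[where B = 1]) (auto simp: indicator_def K_Iic[symmetric], simp add: K_Iic)
    qed auto
    also have "\<dots> = (\<integral>\<^sup>+p. emeasure (K (fst p)) {..x} * indicator X (fst p) \<partial>G)"
      by (intro nn_integral_cong)
         (simp add: finite_measure.emeasure_eq_measure[OF prob_space.finite_measure[OF K_prob]] indicator_def)
    also have "\<dots> = (\<integral>\<^sup>+ c\<in>X. emeasure (K c) {..x} \<partial>distr G borel fst)"
      by (subst nn_integral_distr)
         (auto simp: finite_measure.emeasure_eq_measure[OF prob_space.finite_measure[OF K_prob]] K_Iic)
    finally show ?thesis by (simp add: emeasure_eq_measure)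
  qed
  ultimately show ?thesis using disintegration_if_halflines(2)[OF assms] by blast
qed

section \<open>Consequences of uniform marginals\<close>

text \<open>
  How equality in an estimate of probabilities is exploited: if \<open>P\<close> is contained in \<open>Q\<close> but not
  less likely, the two coincide up to a null set.
\<close>

lemma (in prob_space) AE_imp_if_prob_le:
  assumes [measurable]: "Measurable.pred M P" "Measurable.pred M Q"
    and imp: "AE p in M. P p \<longrightarrow> Q p" and le: "\<P>(p in M. Q p) \<le> \<P>(p in M. P p)"
  shows "AE p in M. Q p \<longrightarrow> P p"
proof -
  have "{p \<in> space M. Q p} - {p \<in> space M. Q p \<and> P p} = {p \<in> space M. Q p \<and> \<not> P p}" by auto
  then have "\<P>(p in M. Q p \<and> \<not> P p) = \<P>(p in M. Q p) - \<P>(p in M. Q p \<and> P p)"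
    by (subst finite_measure_Diff[symmetric]) auto
  also have "\<P>(p in M. Q p \<and> P p) = \<P>(p in M. P p)"
    by (rule prob_eq_AE) (use imp in auto)
  finally have "\<P>(p in M. Q p \<and> \<not> P p) = 0"
    using le measure_nonneg[of M "{p \<in> space M. Q p \<and> \<not> P p}"] by linarith
  then have "AE p in M. \<not> (Q p \<and> \<not> P p)" by (subst (asm) prob_eq_0) auto
  then show ?thesis by eventually_elim auto
qed

lemma joint_uniform_basic:
  assumes "joint_uniform G"
  shows "prob_space G" and "sets G = sets (borel \<Otimes>\<^sub>M borel)" and "space G = UNIV"
    and "distr G borel fst = uniform_measure lborel {0..1}"
    and "distr G borel snd = uniform_measure lborel {0..1}"
proof -
  show "prob_space G" "sets G = sets (borel \<Otimes>\<^sub>M borel)"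
    "distr G borel fst = uniform_measure lborel {0..1}"
    "distr G borel snd = uniform_measure lborel {0..1}"
    using assms by (auto simp: joint_uniform_def)
  then show "space G = UNIV"
    using sets_eq_imp_space_eq[of G "borel \<Otimes>\<^sub>M borel"] by (simp add: space_pair_measure)
qed

lemma cond_law_is_kernel:
  assumes "joint_uniform G"
  shows "is_cond_law G (cond_law G)"
    and "cond_law G \<in> borel \<rightarrow>\<^sub>M prob_algebra borel"
    and "prob_space (cond_law G c)" and "sets (cond_law G c) = sets borel" and "space (cond_law G c) = UNIV"
proof -
  show *: "is_cond_law G (cond_law G)"
    unfolding cond_law_def
    using is_cond_law_exists[OF joint_uniform_basic(1,2)[OF assms]] by (rule someI_ex)
  then show K: "cond_law G \<in> borel \<rightarrow>\<^sub>M prob_algebra borel" by (simp add: is_cond_law_def)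
  show "prob_space (cond_law G c)" "sets (cond_law G c) = sets borel"
    using measurable_space[OF K, of c] by (auto simp: space_prob_algebra)
  then show "space (cond_law G c) = UNIV" using sets_eq_imp_space_eq[of "cond_law G c" borel] by simp
qed

lemma AE_fst_iff:
  assumes "joint_uniform G" and [measurable]: "Measurable.pred borel P"
  shows "(AE p in G. P (fst p)) \<longleftrightarrow> (AE c in lborel. c \<in> {0..1} \<longrightarrow> P c)"
proof -
  note [measurable_cong] = joint_uniform_basic(2)[OF assms(1)]
  have "(AE p in G. P (fst p)) \<longleftrightarrow> (AE c in distr G borel fst. P c)"
    by (subst AE_distr_iff) auto
  then show ?thesis unfolding joint_uniform_basic[OF assms(1)] by (simp add: AE_uniform_measure)
qed

lemma AE_snd_iff:
  assumes "joint_uniform G" and [measurable]: "Measurable.pred borel P"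
  shows "(AE p in G. P (snd p)) \<longleftrightarrow> (AE b in lborel. b \<in> {0..1} \<longrightarrow> P b)"
proof -
  note [measurable_cong] = joint_uniform_basic(2)[OF assms(1)]
  have "(AE p in G. P (snd p)) \<longleftrightarrow> (AE c in distr G borel snd. P c)"
    by (subst AE_distr_iff) auto
  then show ?thesis unfolding joint_uniform_basic[OF assms(1)] by (simp add: AE_uniform_measure)
qed

lemma AE_in_unit_square:
  assumes "joint_uniform G"
  shows "AE p in G. fst p \<in> {0<..1} \<and> snd p \<in> {0<..1}"
proof -
  have "AE c in lborel. c \<in> {0..1} \<longrightarrow> c \<in> {0<..1::real}"
    using AE_lborel_singleton[of "0::real"] by eventually_elim auto
  then have "AE p in G. fst p \<in> {0<..1}" "AE p in G. snd p \<in> {0<..1}"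
    using AE_fst_iff[OF assms, of "\<lambda>c. c \<in> {0<..1}"] AE_snd_iff[OF assms, of "\<lambda>c. c \<in> {0<..1}"] by simp_all
  then show ?thesis by eventually_elim auto
qed

lemma prob_fst_snd_le:
  assumes "joint_uniform G" and "0 \<le> t" "t \<le> 1"
  shows "\<P>(p in G. fst p \<le> t) = t" and "\<P>(p in G. snd p \<le> t) = t" and "\<P>(p in G. snd p < t) = t"
proof -
  note [measurable_cong] = joint_uniform_basic(2)[OF assms(1)]
  have u: "measure (uniform_measure lborel {0..1::real}) {..t} = t"
    "measure (uniform_measure lborel {0..1::real}) {..<t} = t"
  proof -
    have "{0..1} \<inter> {..t} = {0..t}" "{0..1} \<inter> {..<t} = {0..<t}" using assms by auto
    then show "measure (uniform_measure lborel {0..1::real}) {..t} = t"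
      "measure (uniform_measure lborel {0..1::real}) {..<t} = t"
      using assms by (simp_all add: measure_uniform_measure)
  qed
  have "\<P>(p in G. fst p \<le> t) = measure (distr G borel fst) {..t}"
    by (subst measure_distr) (auto intro!: arg_cong[where f = "measure G"])
  then show "\<P>(p in G. fst p \<le> t) = t" unfolding joint_uniform_basic[OF assms(1)] u .
  have "\<P>(p in G. snd p \<le> t) = measure (distr G borel snd) {..t}"
    by (subst measure_distr) (auto intro!: arg_cong[where f = "measure G"])
  then show "\<P>(p in G. snd p \<le> t) = t" unfolding joint_uniform_basic[OF assms(1)] u .
  have "\<P>(p in G. snd p < t) = measure (distr G borel snd) {..<t}"
    by (subst measure_distr) (auto intro!: arg_cong[where f = "measure G"])
  then show "\<P>(p in G. snd p < t) = t" unfolding joint_uniform_basic[OF assms(1)] u .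
qed

lemma nn_integral_joint:
  assumes "joint_uniform G" and f [measurable]: "f \<in> borel_measurable (borel \<Otimes>\<^sub>M borel)"
  shows "(\<integral>\<^sup>+p. f p \<partial>G) = (\<integral>\<^sup>+c. \<integral>\<^sup>+b. f (c, b) \<partial>cond_law G c \<partial>distr G borel fst)"
proof -
  note K = cond_law_is_kernel[OF assms(1)]
  note [measurable_cong] = joint_uniform_basic(2)[OF assms(1)] K(4)
  note [measurable] = K(2)
  let ?L = "\<lambda>c. distr (cond_law G c) (borel \<Otimes>\<^sub>M borel) (Pair c)"
  have L: "?L \<in> distr G borel fst \<rightarrow>\<^sub>M subprob_algebra (borel \<Otimes>\<^sub>M borel)"
    by (intro measurable_prob_algebraD) measurable
  have "(\<integral>\<^sup>+p. f p \<partial>G) = (\<integral>\<^sup>+p. f p \<partial>(distr G borel fst \<bind> ?L))"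
    by (rule arg_cong[where f = "\<lambda>M. integral\<^sup>N M f",
          OF is_cond_law_bind[OF joint_uniform_basic(1,2)[OF assms(1)] K(1)]])
  also have "\<dots> = (\<integral>\<^sup>+c. \<integral>\<^sup>+p. f p \<partial>?L c \<partial>distr G borel fst)"
    by (rule nn_integral_bind[OF f L])
  also have "\<dots> = (\<integral>\<^sup>+c. \<integral>\<^sup>+b. f (c, b) \<partial>cond_law G c \<partial>distr G borel fst)"
    by (intro nn_integral_cong nn_integral_distr) measurable
  finally show ?thesis .
qed

lemma AE_joint_iff:
  assumes "joint_uniform G" and P [measurable]: "Measurable.pred (borel \<Otimes>\<^sub>M borel) P"
  shows "(AE p in G. P p) \<longleftrightarrow> (AE c in lborel. c \<in> {0..1} \<longrightarrow> (AE b in cond_law G c. P (c, b)))"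
proof -
  note K = cond_law_is_kernel[OF assms(1)]
  note [measurable_cong] = joint_uniform_basic(2)[OF assms(1)] K(4)
  note [measurable] = K(2)
  let ?L = "\<lambda>c. distr (cond_law G c) (borel \<Otimes>\<^sub>M borel) (Pair c)"
  have L: "?L \<in> distr G borel fst \<rightarrow>\<^sub>M subprob_algebra (borel \<Otimes>\<^sub>M borel)"
    by (intro measurable_prob_algebraD) measurable
  have "(AE p in G. P p) \<longleftrightarrow> (AE p in (distr G borel fst \<bind> ?L). P p)"
    by (rule arg_cong[where f = "\<lambda>M. AE p in M. P p",
          OF is_cond_law_bind[OF joint_uniform_basic(1,2)[OF assms(1)] K(1)]])
  also have "\<dots> \<longleftrightarrow> (AE c in distr G borel fst. AE p in ?L c. P p)"
    by (rule AE_bind[OF L P])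
  also have "\<dots> \<longleftrightarrow> (AE c in distr G borel fst. AE b in cond_law G c. P (c, b))"
    by (subst AE_distr_iff) measurable
  also have "\<dots> \<longleftrightarrow> (AE c in lborel. c \<in> {0..1} \<longrightarrow> (AE b in cond_law G c. P (c, b)))"
    unfolding joint_uniform_basic[OF assms(1)] by (simp add: AE_uniform_measure)
  finally show ?thesis .
qed

section \<open>Decisions and the performance level\<close>

definition surplus :: "(real \<times> real) measure \<Rightarrow> real \<Rightarrow> real \<Rightarrow> real" where
  "surplus G t c = (\<integral>b. max 0 (t - b) \<partial>cond_law G c)"

lemma performs1_surplus: "performs1 (G, (x, y, z)) c \<longleftrightarrow> surplus G y c \<le> x - c + surplus G z c"
  by (simp add: surplus_def performs1.simps)

text \<open>
  The integrand is nonnegative, so even the default value 0 of a divergent integral agrees with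
  the real part of the extended one, whose measurability holds for every kernel.
\<close>

lemma surplus_measurable:
  assumes "joint_uniform G"
  shows "surplus G t \<in> borel_measurable borel"
proof -
  note K = cond_law_is_kernel[OF assms]
  note [measurable_cong] = K(4)
  note [measurable] = measurable_prob_algebraD[OF K(2)]
  have "surplus G t = (\<lambda>c. enn2real (\<integral>\<^sup>+b. ennreal (max 0 (t - b)) \<partial>cond_law G c))"
    unfolding surplus_def by (intro ext integral_eq_nn_integral) auto
  also have "\<dots> \<in> borel_measurable borel"
    by (intro borel_measurable_enn2real nn_integral_measurable_subprob_algebra2[where N = borel]) measurable
  finally show ?thesis .
qed

lemma performs1_measurable:
  assumes "joint_uniform G"
  shows "Measurable.pred borel (performs1 (G, (x, y, z)))"
proof -
  note [measurable] = surplus_measurable[OF assms]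
  have "Measurable.pred borel (\<lambda>c. surplus G y c \<le> x - c + surplus G z c)" by measurable
  then show ?thesis unfolding performs1_surplus .
qed

lemma AE_cond_law_support:
  assumes "joint_uniform G"
  shows "AE c in lborel. c \<in> {0..1} \<longrightarrow> (AE b in cond_law G c. b \<in> {0..1})"
proof -
  have "AE p in G. snd p \<in> {0..1}" using AE_in_unit_square[OF assms] by eventually_elim auto
  moreover have "Measurable.pred (borel \<Otimes>\<^sub>M borel) (\<lambda>p :: real \<times> real. snd p \<in> {0..1})" by measurable
  ultimately show ?thesis using AE_joint_iff[OF assms, of "\<lambda>p. snd p \<in> {0..1}"] by simp
qed

lemma surplus_integrable:
  assumes "joint_uniform G" and supp: "AE b in cond_law G c. b \<in> {0..1}"
  shows "integrable (cond_law G c) (\<lambda>b. max 0 (t - b))"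
proof -
  interpret prob_space "cond_law G c" by (rule cond_law_is_kernel[OF assms(1)])
  note [measurable_cong] = cond_law_is_kernel(4)[OF assms(1)]
  show ?thesis
  proof (rule integrable_const_bound[where B = "\<bar>t\<bar>"])
    show "AE b in cond_law G c. norm (max 0 (t - b)) \<le> \<bar>t\<bar>" using supp by eventually_elim auto
  qed measurable
qed

text \<open>
  The map \<open>t \<mapsto> max 0 (t - b)\<close> is nondecreasing and 1-Lipschitz.
\<close>

lemma surplus_diff_le:
  assumes G: "joint_uniform G" and supp: "AE b in cond_law G c. b \<in> {0..1}"
  shows "surplus G z c - surplus G y c \<le> max 0 (z - y)"
proof -
  interpret prob_space "cond_law G c" by (rule cond_law_is_kernel[OF G])
  note [simp] = surplus_integrable[OF assms]
  have "surplus G z c - surplus G y c = (\<integral>b. max 0 (z - b) - max 0 (y - b) \<partial>cond_law G c)"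
    by (simp add: surplus_def)
  also have "\<dots> \<le> (\<integral>b. max 0 (z - y) \<partial>cond_law G c)"
    by (rule integral_mono) auto
  finally show ?thesis by (simp add: prob_space)
qed

lemma surplus_0:
  assumes G: "joint_uniform G" and supp: "AE b in cond_law G c. b \<in> {0..1}"
  shows "surplus G 0 c = 0"
  unfolding surplus_def by (rule integral_eq_zero_AE) (use supp in \<open>eventually_elim, auto\<close>)

lemma AE_performs1_le:
  assumes G: "joint_uniform G"
  shows "AE p in G. performs1 (G, (x, y, z)) (fst p) \<longrightarrow> fst p \<le> x + max 0 (z - y)"
proof -
  note [measurable] = performs1_measurable[OF G]
  have "AE c in lborel. c \<in> {0..1} \<longrightarrow> (performs1 (G, (x, y, z)) c \<longrightarrow> c \<le> x + max 0 (z - y))"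
    using AE_cond_law_support[OF G]
  proof eventually_elim
    case (elim c)
    then show ?case using surplus_diff_le[OF G, of c z y] unfolding performs1_surplus by auto
  qed
  then show ?thesis
    by (subst AE_fst_iff[OF G, of "\<lambda>c. performs1 (G, (x, y, z)) c \<longrightarrow> c \<le> x + max 0 (z - y)"])
      measurable
qed

lemma performs2_measurable:
  assumes "joint_uniform G"
  shows "Measurable.pred (borel \<Otimes>\<^sub>M borel) (\<lambda>p. performs2 (G, (x, y, z)) (fst p) (snd p))"
proof -
  note [measurable] = performs1_measurable[OF assms]
  show ?thesis unfolding performs2.simps by measurable
qed

lemma performance_eq_probs:
  assumes "joint_uniform G"
  shows "performance (G, (x, y, z)) =
    \<P>(p in G. performs1 (G, (x, y, z)) (fst p)) + \<P>(p in G. performs2 (G, (x, y, z)) (fst p) (snd p))"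
proof -
  interpret prob_space G by (rule joint_uniform_basic[OF assms])
  note [measurable_cong] = joint_uniform_basic(2)[OF assms]
  note [measurable] = performs1_measurable[OF assms] performs2_measurable[OF assms]
  let ?P = "\<lambda>p. performs1 (G, (x, y, z)) (fst p)" and ?Q = "\<lambda>p. performs2 (G, (x, y, z)) (fst p) (snd p)"
  have "performance (G, (x, y, z)) = (\<integral>p. indicator {p \<in> space G. ?P p} p + indicator {p \<in> space G. ?Q p} p \<partial>G)"
    unfolding performance_def fst_conv
    by (intro Bochner_Integration.integral_cong)
      (auto simp: indicator_def case_prod_beta)
  also have "\<dots> = \<P>(p in G. ?P p) + \<P>(p in G. ?Q p)"
    by (subst Bochner_Integration.integral_add) (auto intro!: integrable_const_bound[where B = 1])
  finally show ?thesis .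
qed

section \<open>The upper bound and its equality case\<close>

lemma performance_bounds:
  assumes G: "joint_uniform G" and "feasible w (x, y, z)" and "w \<le> 1"
  shows "performance (G, (x, y, z)) \<le> \<P>(p in G. performs1 (G, (x, y, z)) (fst p)) + max y z"
    and "\<P>(p in G. performs1 (G, (x, y, z)) (fst p)) \<le> x + max 0 (z - y)"
    and "\<P>(p in G. performs2 (G, (x, y, z)) (fst p) (snd p)) \<le> max y z"
proof -
  interpret prob_space G by (rule joint_uniform_basic[OF G])
  note [measurable_cong] = joint_uniform_basic(2)[OF G]
  note [measurable] = performs1_measurable[OF G] performs2_measurable[OF G]
  have le: "0 \<le> x" "0 \<le> y" "0 \<le> z" "x + z \<le> w" "y \<le> w" using assms by auto
  have "\<P>(p in G. performs1 (G, (x, y, z)) (fst p)) \<le> \<P>(p in G. fst p \<le> x + max 0 (z - y))"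
    by (rule finite_measure_mono_AE) (use AE_performs1_le[OF G] in auto)
  then show "\<P>(p in G. performs1 (G, (x, y, z)) (fst p)) \<le> x + max 0 (z - y)"
    using prob_fst_snd_le(1)[OF G, of "x + max 0 (z - y)"] le \<open>w \<le> 1\<close> by auto
  have "\<P>(p in G. performs2 (G, (x, y, z)) (fst p) (snd p)) \<le> \<P>(p in G. snd p \<le> max y z)"
    by (rule finite_measure_mono) (auto simp: performs2.simps split: if_splits)
  then show *: "\<P>(p in G. performs2 (G, (x, y, z)) (fst p) (snd p)) \<le> max y z"
    using prob_fst_snd_le(2)[OF G, of "max y z"] le \<open>w \<le> 1\<close> by auto
  then show "performance (G, (x, y, z)) \<le> \<P>(p in G. performs1 (G, (x, y, z)) (fst p)) + max y z"
    unfolding performance_eq_probs[OF G] by simp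
qed

lemma performance_le:
  assumes G: "joint_uniform G" and "feasible w (x, y, z)" and "w \<le> 1"
  shows "performance (G, (x, y, z)) \<le> 2 * w"
  using performance_bounds[OF assms] assms(2) by (auto simp: max_def split: if_splits)

text \<open>
  Adding the bounds on the two periods gives \<open>x + 2 * z - y\<close> if \<open>y \<le> z\<close> and \<open>x + y\<close> otherwise;
  under the budget constraints each of these reaches \<open>2 * w\<close> for a single rule.
\<close>

lemma tight_rules:
  assumes G: "joint_uniform G" and "feasible w (x, y, z)" and "w \<le> 1"
    and "2 * w \<le> performance (G, (x, y, z))"
  shows "(x, y, z) = (0, 0, w) \<or> (x, y, z) = (w, w, 0)"
    and "w \<le> \<P>(p in G. performs1 (G, (x, y, z)) (fst p))"
    and "w \<le> \<P>(p in G. performs2 (G, (x, y, z)) (fst p) (snd p))"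
proof -
  note b = performance_bounds[OF assms(1-3)]
  note p = performance_eq_probs[OF G, of x y z]
  have le: "0 \<le> x" "0 \<le> y" "0 \<le> z" "x + z \<le> w" "y \<le> w" using assms(2) by auto
  show "w \<le> \<P>(p in G. performs1 (G, (x, y, z)) (fst p))"
    using b le assms(4) by linarith
  show "w \<le> \<P>(p in G. performs2 (G, (x, y, z)) (fst p) (snd p))"
    using b p le assms(4) by linarith
  show "(x, y, z) = (0, 0, w) \<or> (x, y, z) = (w, w, 0)"
  proof (cases "y \<le> z")
    case True
    then have "2 * w \<le> x + (z - y) + z" using b assms(4) by (simp add: max_def)
    then have "x = 0 \<and> y = 0 \<and> z = w" using le by auto
    then show ?thesis by simp
  next
    case False
    then have "2 * w \<le> x + y" using b assms(4) by (simp add: max_def)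
    then have "x = w \<and> y = w \<and> z = 0" using le by auto
    then show ?thesis by simp
  qed
qed

text \<open>
  Up to a null set, the period-1 costs at which the agent performs lie in \<open>{..w}\<close>, which has
  probability \<open>w\<close>.
\<close>

lemma AE_performs1_if_prob_ge:
  assumes G: "joint_uniform G" and "0 \<le> w" "w \<le> 1" and "x + max 0 (z - y) = w"
    and "w \<le> \<P>(p in G. performs1 (G, (x, y, z)) (fst p))"
  shows "AE p in G. fst p \<le> w \<longrightarrow> performs1 (G, (x, y, z)) (fst p)"
proof -
  interpret prob_space G by (rule joint_uniform_basic[OF G])
  note [measurable_cong] = joint_uniform_basic(2)[OF G]
  note [measurable] = performs1_measurable[OF G]
  show ?thesis
  proof (rule AE_imp_if_prob_le)
    show "AE p in G. performs1 (G, (x, y, z)) (fst p) \<longrightarrow> fst p \<le> w"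
      using AE_performs1_le[OF G, of x y z] assms(4) by simp
    show "\<P>(p in G. fst p \<le> w) \<le> \<P>(p in G. performs1 (G, (x, y, z)) (fst p))"
      using prob_fst_snd_le(1)[OF G assms(2,3)] assms(5) by simp
  qed measurable
qed

section \<open>Pure schemes\<close>

text \<open>
  Disintegration turns a condition on almost every conditional law into an almost sure property of
  the pair of costs, which is what the counting of performances uses; \<open>w \<le> 1\<close> keeps the
  relevant \<open>c\<close> where the first marginal has a positive density.
\<close>

lemma sufficient_iff:
  assumes G: "joint_uniform G" and "0 \<le> w" "w \<le> 1"
  shows "(AE c in lborel. c \<in> {0..w} \<longrightarrow> measure (cond_law G c) {w..} = 1) \<longleftrightarrow>
    (AE p in G. fst p \<in> {0..w} \<longrightarrow> w \<le> snd p)"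
proof -
  have eq: "(c \<in> {0..1} \<longrightarrow> (AE b in cond_law G c. c \<in> {0..w} \<longrightarrow> w \<le> b)) \<longleftrightarrow>
      (c \<in> {0..w} \<longrightarrow> measure (cond_law G c) {w..} = 1)" for c
  proof (cases "c \<in> {0..w}")
    case True
    interpret K: prob_space "cond_law G c" by (rule cond_law_is_kernel[OF G])
    have "measure (cond_law G c) {w..} = 1 \<longleftrightarrow> (AE b in cond_law G c. b \<in> {w..})"
      by (rule K.prob_eq_1) (simp add: cond_law_is_kernel[OF G])
    with True assms show ?thesis by simp
  qed auto
  have "Measurable.pred (borel \<Otimes>\<^sub>M borel) (\<lambda>p :: real \<times> real. fst p \<in> {0..w} \<longrightarrow> w \<le> snd p)"
    by measurable
  from AE_joint_iff[OF G this] show ?thesis by (simp only: fst_conv snd_conv eq)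
qed

lemma sustained_iff:
  assumes G: "joint_uniform G" and "0 \<le> w" "w \<le> 1"
  shows "(AE c in lborel. c \<in> {0..w} \<longrightarrow> (AE b in cond_law G c. b = w - c)) \<longleftrightarrow>
    (AE p in G. fst p \<in> {0..w} \<longrightarrow> snd p = w - fst p)"
proof -
  have eq: "(c \<in> {0..1} \<longrightarrow> (AE b in cond_law G c. c \<in> {0..w} \<longrightarrow> b = w - c)) \<longleftrightarrow>
      (c \<in> {0..w} \<longrightarrow> (AE b in cond_law G c. b = w - c))" for c
    using assms by (cases "c \<in> {0..w}") auto
  have "Measurable.pred (borel \<Otimes>\<^sub>M borel) (\<lambda>p :: real \<times> real. fst p \<in> {0..w} \<longrightarrow> snd p = w - fst p)"
    by measurable
  from AE_joint_iff[OF G this] show ?thesis by (simp only: fst_conv snd_conv eq)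
qed

text \<open>
  At cost \<open>c \<le> w\<close> the surplus \<open>w - (w - c)\<close> from period 2 exactly covers the cost, so the agent
  is indifferent and performs; he then performs again since \<open>w - c \<le> w\<close>.
\<close>

lemma sustained_performance:
  assumes G: "joint_uniform G" and w: "0 \<le> w" "w \<le> 1"
    and ae: "AE p in G. fst p \<in> {0..w} \<longrightarrow> snd p = w - fst p"
  shows "2 * w \<le> performance (G, (0, 0, w))"
proof -
  interpret prob_space G by (rule joint_uniform_basic[OF G])
  note [measurable_cong] = joint_uniform_basic(2)[OF G]
  note [measurable] = performs1_measurable[OF G] performs2_measurable[OF G]
  have "AE c in lborel. c \<in> {0..1} \<longrightarrow> (c \<le> w \<longrightarrow> performs1 (G, (0, 0, w)) c)"
    using ae[folded sustained_iff[OF G w]] AE_cond_law_support[OF G]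
  proof eventually_elim
    case (elim c)
    show ?case
    proof (intro impI)
      assume c: "c \<in> {0..1}" "c \<le> w"
      interpret K: prob_space "cond_law G c" by (rule cond_law_is_kernel[OF G])
      note [measurable_cong] = cond_law_is_kernel(4)[OF G]
      have "AE b in cond_law G c. b = w - c" using elim c by auto
      then have "AE b in cond_law G c. max 0 (w - b) = c" by eventually_elim (use c in auto)
      then have "surplus G w c = (\<integral>b. c \<partial>cond_law G c)"
        unfolding surplus_def by (intro integral_cong_AE) simp_all
      moreover have "surplus G 0 c = 0" by (rule surplus_0[OF G]) (use elim c in auto)
      ultimately show "performs1 (G, (0, 0, w)) c"
        unfolding performs1_surplus by (simp add: K.prob_space)
    qed
  qed
  then have p1: "AE p in G. fst p \<le> w \<longrightarrow> performs1 (G, (0, 0, w)) (fst p)"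
    by (subst AE_fst_iff[OF G, of "\<lambda>c. c \<le> w \<longrightarrow> performs1 (G, (0, 0, w)) c"]) measurable
  have "\<P>(p in G. fst p \<le> w) \<le> \<P>(p in G. performs1 (G, (0, 0, w)) (fst p))"
    by (rule finite_measure_mono_AE) (use p1 in auto)
  moreover have "\<P>(p in G. fst p \<le> w) \<le> \<P>(p in G. performs2 (G, (0, 0, w)) (fst p) (snd p))"
  proof (rule finite_measure_mono_AE)
    show "AE p in G. p \<in> {p \<in> space G. fst p \<le> w} \<longrightarrow>
        p \<in> {p \<in> space G. performs2 (G, (0, 0, w)) (fst p) (snd p)}"
      using p1 ae AE_in_unit_square[OF G] by eventually_elim (auto simp: performs2.simps)
  qed measurable
  ultimately show ?thesis
    unfolding performance_eq_probs[OF G] using prob_fst_snd_le(1)[OF G w] by linarith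
qed

text \<open>
  At cost \<open>c \<le> w\<close> waiting is worthless, because the period-2 cost is at least \<open>w\<close>, so the agent
  performs in period 1. Every period-2 cost below \<open>w\<close> is thus paired with a cost above \<open>w\<close> in
  period 1, where he did not perform and the reward \<open>w\<close> is on offer.
\<close>

lemma sufficient_performance:
  assumes G: "joint_uniform G" and w: "0 \<le> w" "w \<le> 1"
    and ae: "AE p in G. fst p \<in> {0..w} \<longrightarrow> w \<le> snd p"
  shows "2 * w \<le> performance (G, (w, w, 0))"
proof -
  interpret prob_space G by (rule joint_uniform_basic[OF G])
  note [measurable_cong] = joint_uniform_basic(2)[OF G]
  note [measurable] = performs1_measurable[OF G] performs2_measurable[OF G]
  have "AE c in lborel. c \<in> {0..1} \<longrightarrow> (c \<le> w \<longrightarrow> performs1 (G, (w, w, 0)) c)"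
    using ae[folded sufficient_iff[OF G w]] AE_cond_law_support[OF G]
  proof eventually_elim
    case (elim c)
    show ?case
    proof (intro impI)
      assume c: "c \<in> {0..1}" "c \<le> w"
      interpret K: prob_space "cond_law G c" by (rule cond_law_is_kernel[OF G])
      have "measure (cond_law G c) {w..} = 1" using elim c by auto
      then have "AE b in cond_law G c. b \<in> {w..}"
        by (subst (asm) K.prob_eq_1) (auto simp: cond_law_is_kernel[OF G])
      then have "AE b in cond_law G c. max 0 (w - b) = 0" by eventually_elim auto
      then have "surplus G w c = 0" unfolding surplus_def by (rule integral_eq_zero_AE)
      moreover have "surplus G 0 c = 0" by (rule surplus_0[OF G]) (use elim c in auto)
      ultimately show "performs1 (G, (w, w, 0)) c"
        unfolding performs1_surplus using c by simp
    qed
  qed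
  then have p1: "AE p in G. fst p \<le> w \<longrightarrow> performs1 (G, (w, w, 0)) (fst p)"
    by (subst AE_fst_iff[OF G, of "\<lambda>c. c \<le> w \<longrightarrow> performs1 (G, (w, w, 0)) c"]) measurable
  have "\<P>(p in G. fst p \<le> w) \<le> \<P>(p in G. performs1 (G, (w, w, 0)) (fst p))"
    by (rule finite_measure_mono_AE) (use p1 in auto)
  moreover have "\<P>(p in G. snd p < w) \<le> \<P>(p in G. performs2 (G, (w, w, 0)) (fst p) (snd p))"
  proof (rule finite_measure_mono_AE)
    show "AE p in G. p \<in> {p \<in> space G. snd p < w} \<longrightarrow>
        p \<in> {p \<in> space G. performs2 (G, (w, w, 0)) (fst p) (snd p)}"
      using AE_performs1_le[OF G, of w w 0] ae AE_in_unit_square[OF G]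
      by eventually_elim (use w in \<open>auto simp: performs2.simps\<close>)
  qed measurable
  ultimately show ?thesis
    unfolding performance_eq_probs[OF G] using prob_fst_snd_le(1,3)[OF G w] by linarith
qed

text \<open>
  Almost every \<open>b \<le> w\<close> meets performance in period 2. After performance in period 1, hence
  whenever \<open>c \<le> w\<close>, the reward is 0 and this would force \<open>b \<le> 0\<close>, a null event.
\<close>

lemma sufficient_if_tight:
  assumes G: "joint_uniform G" and w: "0 \<le> w" "w \<le> 1"
    and p1: "w \<le> \<P>(p in G. performs1 (G, (w, w, 0)) (fst p))"
    and p2: "w \<le> \<P>(p in G. performs2 (G, (w, w, 0)) (fst p) (snd p))"
  shows "AE p in G. fst p \<in> {0..w} \<longrightarrow> w \<le> snd p"
proof -
  interpret prob_space G by (rule joint_uniform_basic[OF G])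
  note [measurable_cong] = joint_uniform_basic(2)[OF G]
  note [measurable] = performs1_measurable[OF G] performs2_measurable[OF G]
  have "AE p in G. fst p \<le> w \<longrightarrow> performs1 (G, (w, w, 0)) (fst p)"
    by (rule AE_performs1_if_prob_ge[OF G]) (use w p1 in auto)
  moreover have "AE p in G. snd p \<le> w \<longrightarrow> performs2 (G, (w, w, 0)) (fst p) (snd p)"
    by (rule AE_imp_if_prob_le)
      (use w p2 prob_fst_snd_le(2)[OF G w] in \<open>auto simp: performs2.simps split: if_splits\<close>)
  ultimately show ?thesis
    using AE_in_unit_square[OF G]
    by eventually_elim (auto simp: performs2.simps split: if_splits)
qed

lemma no_sufficient_coupling:
  assumes G: "joint_uniform G" and w: "1/2 < w" "w \<le> 1"
  shows "\<not> (AE p in G. fst p \<in> {0..w} \<longrightarrow> w \<le> snd p)"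
proof
  assume ae: "AE p in G. fst p \<in> {0..w} \<longrightarrow> w \<le> snd p"
  interpret prob_space G by (rule joint_uniform_basic[OF G])
  note [measurable_cong] = joint_uniform_basic(2)[OF G]
  have "\<P>(p in G. fst p \<le> w) \<le> \<P>(p in G. \<not> snd p < w)"
    by (rule finite_measure_mono_AE) (use ae AE_in_unit_square[OF G] in \<open>eventually_elim, auto\<close>, measurable)
  also have "\<dots> = 1 - \<P>(p in G. snd p < w)"
    by (rule prob_neg) measurable
  finally show False using prob_fst_snd_le[OF G, of w] w by auto
qed

section \<open>Rigidity of tight sustained schemes\<close>

lemma nn_integral_uniform:
  assumes [measurable]: "f \<in> borel_measurable borel"
  shows "(\<integral>\<^sup>+x. f x \<partial>uniform_measure lborel {0..1::real}) = (\<integral>\<^sup>+x. f x * indicator {0..1} x \<partial>lborel)"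
  by (subst nn_integral_uniform_measure) (auto simp: divide_ennreal_def)

text \<open>
  The reflection of \<open>{0..w}\<close> at its midpoint exchanges the two integrands.
\<close>

lemma second_moments_agree:
  assumes w: "0 \<le> w" "w \<le> 1"
  shows "(\<integral>\<^sup>+b. ennreal ((max 0 (w - b))\<^sup>2) \<partial>uniform_measure lborel {0..1}) =
    (\<integral>\<^sup>+c. ennreal ((c * indicator {0..w} c)\<^sup>2) \<partial>uniform_measure lborel {0..1})"
proof -
  have "(\<integral>\<^sup>+b. ennreal ((max 0 (w - b))\<^sup>2) \<partial>uniform_measure lborel {0..1}) =
      (\<integral>\<^sup>+b. ennreal ((max 0 (w - b))\<^sup>2) * indicator {0..1} b \<partial>lborel)"
    by (rule nn_integral_uniform) measurable
  also have "\<dots> = (\<integral>\<^sup>+c. ennreal ((max 0 (w - (w + (- 1) * c)))\<^sup>2) * indicator {0..1} (w + (- 1) * c) \<partial>lborel)"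
    by (subst nn_integral_real_affine[where c = "- 1" and t = w]) auto
  also have "\<dots> = (\<integral>\<^sup>+c. ennreal ((c * indicator {0..w} c)\<^sup>2) * indicator {0..1} c \<partial>lborel)"
    by (intro nn_integral_cong) (use w in \<open>auto simp: indicator_def\<close>)
  also have "\<dots> = (\<integral>\<^sup>+c. ennreal ((c * indicator {0..w} c)\<^sup>2) \<partial>uniform_measure lborel {0..1})"
    by (rule nn_integral_uniform[symmetric]) measurable
  finally show ?thesis .
qed

text \<open>
  With \<open>V = max 0 (w - B)\<close> and \<open>T\<close> the truncation of \<open>A\<close> to \<open>{0..w}\<close>, the hypothesis bounds the
  conditional mean of \<open>V\<close> from below by \<open>T\<close>. As \<open>T \<ge> 0\<close>, this gives \<open>E (T V) \<ge> E T\<^sup>2\<close>, and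
  together with \<open>E V\<^sup>2 = E T\<^sup>2\<close> it makes \<open>E (V - T)\<^sup>2 = E V\<^sup>2 + E T\<^sup>2 - 2 E (T V)\<close> nonpositive.
  So a one-sided bound on the conditional mean already determines the joint law on \<open>A \<le> w\<close>.
\<close>

lemma sustained_if_surplus_ge:
  assumes G: "joint_uniform G" and w: "0 \<le> w" "w \<le> 1"
    and ge: "AE c in lborel. c \<in> {0..w} \<longrightarrow> c \<le> surplus G w c"
  shows "AE p in G. fst p \<in> {0..w} \<longrightarrow> snd p = w - fst p"
proof -
  interpret prob_space G by (rule joint_uniform_basic[OF G])
  note [measurable_cong] = joint_uniform_basic(2)[OF G]
  define V T :: "real \<Rightarrow> real" where "V b = max 0 (w - b)" and "T c = c * indicator {0..w} c" for b c
  have [measurable]: "V \<in> borel_measurable borel" "T \<in> borel_measurable borel"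
    unfolding V_def T_def by measurable
  have T: "0 \<le> T c" "T c \<le> 1" for c using w by (auto simp: T_def indicator_def)
  have V: "AE p in G. 0 \<le> V (snd p) \<and> V (snd p) \<le> 1"
    using AE_in_unit_square[OF G] by eventually_elim (use w in \<open>auto simp: V_def\<close>)
  have V0: "0 \<le> V b" for b by (simp add: V_def)
  have int: "integrable G (\<lambda>p. (V (snd p))\<^sup>2)" "integrable G (\<lambda>p. (T (fst p))\<^sup>2)"
    "integrable G (\<lambda>p. T (fst p) * V (snd p))"
  proof -
    show "integrable G (\<lambda>p. (V (snd p))\<^sup>2)"
      by (rule integrable_const_bound[where B = 1])
        (use V in \<open>eventually_elim, simp add: power_le_one\<close>, measurable)
    show "integrable G (\<lambda>p. (T (fst p))\<^sup>2)"
      by (rule integrable_const_bound[where B = 1]) (use T in \<open>auto intro!: power_le_one\<close>)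
    show "integrable G (\<lambda>p. T (fst p) * V (snd p))"
      by (rule integrable_const_bound[where B = 1])
        (use V in \<open>eventually_elim, simp add: T abs_mult mult_le_one\<close>, measurable)
  qed
  have "(\<integral>\<^sup>+p. ennreal ((V (snd p))\<^sup>2) \<partial>G) = (\<integral>\<^sup>+b. ennreal ((V b)\<^sup>2) \<partial>distr G borel snd)"
    by (subst nn_integral_distr) measurable
  also have "\<dots> = (\<integral>\<^sup>+c. ennreal ((T c)\<^sup>2) \<partial>distr G borel fst)"
    unfolding joint_uniform_basic[OF G] V_def T_def by (rule second_moments_agree[OF w])
  also have TT: "\<dots> = (\<integral>\<^sup>+p. ennreal ((T (fst p))\<^sup>2) \<partial>G)"
    by (subst nn_integral_distr) measurable
  finally have VV: "(\<integral>p. (V (snd p))\<^sup>2 \<partial>G) = (\<integral>p. (T (fst p))\<^sup>2 \<partial>G)"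
    by (simp add: integral_eq_nn_integral)
  have "(\<integral>\<^sup>+p. ennreal ((T (fst p))\<^sup>2) \<partial>G) = (\<integral>\<^sup>+c. ennreal ((T c)\<^sup>2) \<partial>distr G borel fst)"
    by (rule TT[symmetric])
  also have "\<dots> \<le> (\<integral>\<^sup>+c. \<integral>\<^sup>+b. ennreal (T c * V b) \<partial>cond_law G c \<partial>distr G borel fst)"
  proof (rule nn_integral_mono_AE)
    have "AE c in lborel. c \<in> {0..1} \<longrightarrow>
        ennreal ((T c)\<^sup>2) \<le> (\<integral>\<^sup>+b. ennreal (T c * V b) \<partial>cond_law G c)"
      using ge AE_cond_law_support[OF G]
    proof eventually_elim
      case (elim c)
      show ?case
      proof
        assume c: "c \<in> {0..1}"
        then have "AE b in cond_law G c. b \<in> {0..1}" using elim by simp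
        note int_surplus = surplus_integrable[OF G this, of w]
        have "0 \<le> surplus G w c" by (simp add: surplus_def)
        then have "T c * T c \<le> T c * surplus G w c"
          using elim c T(1)[of c] by (intro mult_left_mono) (auto simp: T_def indicator_def)
        then have "(T c)\<^sup>2 \<le> (\<integral>b. T c * V b \<partial>cond_law G c)"
          using int_surplus by (simp add: V_def surplus_def power2_eq_square)
        also have "ennreal \<dots> = (\<integral>\<^sup>+b. ennreal (T c * V b) \<partial>cond_law G c)"
          using int_surplus T(1)[of c]
          by (intro nn_integral_eq_integral[symmetric]) (auto simp: V_def)
        finally show "ennreal ((T c)\<^sup>2) \<le> (\<integral>\<^sup>+b. ennreal (T c * V b) \<partial>cond_law G c)"
          by (simp add: ennreal_leI)
      qed
    qed
    then show "AE c in distr G borel fst. ennreal ((T c)\<^sup>2) \<le> (\<integral>\<^sup>+b. ennreal (T c * V b) \<partial>cond_law G c)"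
      unfolding joint_uniform_basic[OF G] by (simp add: AE_uniform_measure)
  qed
  also have "\<dots> = (\<integral>\<^sup>+p. ennreal (T (fst p) * V (snd p)) \<partial>G)"
    by (subst nn_integral_joint[OF G]) simp_all
  finally have "ennreal (\<integral>p. (T (fst p))\<^sup>2 \<partial>G) \<le> ennreal (\<integral>p. T (fst p) * V (snd p) \<partial>G)"
    by (simp add: nn_integral_eq_integral int T V0)
  then have TV: "(\<integral>p. (T (fst p))\<^sup>2 \<partial>G) \<le> (\<integral>p. T (fst p) * V (snd p) \<partial>G)"
    by (subst (asm) ennreal_le_iff) (auto intro!: integral_nonneg_AE simp: T V0)
  have eq: "(V (snd p) - T (fst p))\<^sup>2 = (V (snd p))\<^sup>2 + (T (fst p))\<^sup>2 - 2 * (T (fst p) * V (snd p))" for p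
    by (simp add: power2_diff)
  have int_sq: "integrable G (\<lambda>p. (V (snd p) - T (fst p))\<^sup>2)"
    unfolding eq using int by auto
  have "(\<integral>p. (V (snd p) - T (fst p))\<^sup>2 \<partial>G) \<le> 0"
    unfolding eq using int TV VV by simp
  then have "(\<integral>p. (V (snd p) - T (fst p))\<^sup>2 \<partial>G) = 0"
    by (intro antisym integral_nonneg_AE) auto
  then have "AE p in G. (V (snd p) - T (fst p))\<^sup>2 = 0"
    using integral_nonneg_eq_0_iff_AE[OF int_sq] by simp
  \<comment> \<open>Where A > 0, V = A is positive, so the maximum in V is attained by w - B.\<close>
  then show ?thesis using AE_in_unit_square[OF G]
    by eventually_elim (auto simp: V_def T_def max_def split: if_splits)
qed

section \<open>Optimal schemes\<close>

lemma reflection_preserves_uniform: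
  assumes w: "0 \<le> w" "w \<le> 1"
  shows "distr (uniform_measure lborel {0..1}) borel (\<lambda>u. if u \<in> {0..w} then w - u else u)
    = uniform_measure lborel {0..1::real}" (is "distr ?U borel ?r = _")
proof (rule measure_eqI)
  fix X :: "real set" assume "X \<in> sets (distr ?U borel ?r)"
  then have [measurable]: "X \<in> sets borel" by simp
  have [measurable]: "?r \<in> borel_measurable borel" by measurable
  have "emeasure (distr ?U borel ?r) X = (\<integral>\<^sup>+u. indicator X (?r u) \<partial>?U)"
  proof -
    have "emeasure (distr ?U borel ?r) X = (\<integral>\<^sup>+u. indicator X u \<partial>distr ?U borel ?r)" by simp
    also have "\<dots> = (\<integral>\<^sup>+u. indicator X (?r u) \<partial>?U)" by (rule nn_integral_distr) measurable
    finally show ?thesis .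
  qed
  also have "\<dots> = (\<integral>\<^sup>+u. indicator X (?r u) * indicator {0..1} u \<partial>lborel)"
    by (rule nn_integral_uniform) measurable
  also have "\<dots> = (\<integral>\<^sup>+u. indicator (X \<inter> {0..w}) (w + (- 1) * u) + indicator (X \<inter> {w<..1}) u \<partial>lborel)"
    by (intro nn_integral_cong) (use w in \<open>auto simp: indicator_def\<close>)
  also have "\<dots> = (\<integral>\<^sup>+u. indicator (X \<inter> {0..w}) (w + (- 1) * u) \<partial>lborel) + (\<integral>\<^sup>+u. indicator (X \<inter> {w<..1}) u \<partial>lborel)"
    by (rule nn_integral_add) measurable
  also have "(\<integral>\<^sup>+u. indicator (X \<inter> {0..w}) (w + (- 1) * u) \<partial>lborel) = (\<integral>\<^sup>+u. indicator (X \<inter> {0..w}) u \<partial>lborel)"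
    by (subst (2) nn_integral_real_affine[where c = "- 1" and t = w]) auto
  also have "\<dots> + (\<integral>\<^sup>+u. indicator (X \<inter> {w<..1}) u \<partial>lborel) =
      (\<integral>\<^sup>+u. indicator (X \<inter> {0..w}) u + indicator (X \<inter> {w<..1}) u \<partial>lborel)"
    by (rule nn_integral_add[symmetric]) measurable
  also have "\<dots> = (\<integral>\<^sup>+u. indicator X u * indicator {0..1} u \<partial>lborel)"
    by (intro nn_integral_cong) (use w in \<open>auto simp: indicator_def\<close>)
  also have "\<dots> = (\<integral>\<^sup>+u. indicator X u \<partial>?U)"
    by (rule nn_integral_uniform[symmetric]) measurable
  finally show "emeasure (distr ?U borel ?r) X = emeasure ?U X" by simp
qed simp

text \<open>
  Take \<open>A\<close> uniform and let \<open>B\<close> be its image under the map that reflects \<open>{0..w}\<close> and fixes the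
  rest of the unit interval.
\<close>

lemma sustained_coupling_exists:
  assumes w: "0 \<le> w" "w \<le> 1"
  shows "\<exists>G. joint_uniform G \<and> (AE p in G. fst p \<in> {0..w} \<longrightarrow> snd p = w - fst p)"
proof -
  let ?U = "uniform_measure lborel {0..1::real}"
  let ?r = "\<lambda>u. if u \<in> {0..w} then w - u else u"
  let ?G = "distr ?U (borel \<Otimes>\<^sub>M borel) (\<lambda>u. (u, ?r u))"
  interpret U: prob_space ?U by (rule prob_space_uniform_measure) auto
  have m: "(\<lambda>u. (u, ?r u)) \<in> ?U \<rightarrow>\<^sub>M borel \<Otimes>\<^sub>M borel" by measurable
  have "distr ?G borel fst = distr ?U borel (\<lambda>u. u)"
    by (subst distr_distr[OF _ m]) (auto simp: comp_def)
  also have "\<dots> = ?U" by (rule distr_id2) simp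
  finally have fst: "distr ?G borel fst = ?U" .
  have "distr ?G borel snd = distr ?U borel ?r"
    by (subst distr_distr[OF _ m]) (auto simp: comp_def)
  also have "\<dots> = ?U" by (rule reflection_preserves_uniform[OF w])
  finally have snd: "distr ?G borel snd = ?U" .
  have "joint_uniform ?G"
    unfolding joint_uniform_def using fst snd U.prob_space_distr[OF m] by simp
  moreover have "AE p in ?G. fst p \<in> {0..w} \<longrightarrow> snd p = w - fst p"
  proof (subst AE_distr_iff[OF m])
    show "{p \<in> space (borel \<Otimes>\<^sub>M borel). fst p \<in> {0..w} \<longrightarrow> snd p = w - fst p}
        \<in> sets (borel \<Otimes>\<^sub>M borel :: (real \<times> real) measure)"
      by measurable
  qed auto
  ultimately show ?thesis by blast
qed

text \<open>
  Under the rule \<open>(0, 0, w)\<close>, performing at cost \<open>c\<close> means that the surplus from reward \<open>w\<close> is at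
  least \<open>c\<close>: the surplus from reward 0 vanishes for almost every \<open>c\<close>, since costs are
  nonnegative.
\<close>

lemma sustained_if_tight:
  assumes G: "joint_uniform G" and w: "0 \<le> w" "w \<le> 1"
    and p1: "w \<le> \<P>(p in G. performs1 (G, (0, 0, w)) (fst p))"
  shows "AE p in G. fst p \<in> {0..w} \<longrightarrow> snd p = w - fst p"
proof (rule sustained_if_surplus_ge[OF G w])
  note [measurable] = performs1_measurable[OF G]
  have "AE p in G. fst p \<le> w \<longrightarrow> performs1 (G, (0, 0, w)) (fst p)"
    by (rule AE_performs1_if_prob_ge[OF G w _ p1]) (use w in simp)
  then have "AE c in lborel. c \<in> {0..1} \<longrightarrow> (c \<le> w \<longrightarrow> performs1 (G, (0, 0, w)) c)"
    by (subst (asm) AE_fst_iff[OF G, of "\<lambda>c. c \<le> w \<longrightarrow> performs1 (G, (0, 0, w)) c"]) measurable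
  then show "AE c in lborel. c \<in> {0..w} \<longrightarrow> c \<le> surplus G w c"
    using AE_cond_law_support[OF G]
  proof eventually_elim
    case (elim c)
    then show ?case using w surplus_0[OF G, of c] by (auto simp: performs1_surplus)
  qed
qed

lemma optimal_iff_performance:
  assumes G: "joint_uniform G" and feas: "feasible w (x, y, z)" and w: "0 \<le> w" "w \<le> 1"
  shows "optimal w (G, (x, y, z)) \<longleftrightarrow> 2 * w \<le> performance (G, (x, y, z))"
proof
  assume opt: "optimal w (G, (x, y, z))"
  obtain H where H: "joint_uniform H" "AE p in H. fst p \<in> {0..w} \<longrightarrow> snd p = w - fst p"
    using sustained_coupling_exists[OF w] by blast
  have "is_scheme w (H, (0, 0, w))" using H(1) w by (simp add: is_scheme_def)
  then have "performance (H, (0, 0, w)) \<le> performance (G, (x, y, z))"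
    using opt by (simp add: optimal_def)
  then show "2 * w \<le> performance (G, (x, y, z))"
    using sustained_performance[OF H(1) w H(2)] by simp
next
  assume ge: "2 * w \<le> performance (G, (x, y, z))"
  have "performance t \<le> 2 * w" if "is_scheme w t" for t
  proof -
    obtain H x' y' z' where t: "t = (H, (x', y', z'))" by (metis prod.exhaust)
    show ?thesis using that w performance_le[of H w x' y' z'] unfolding t is_scheme_def by simp
  qed
  with ge G feas show "optimal w (G, (x, y, z))"
    unfolding optimal_def is_scheme_def by (metis fst_conv order.trans snd_conv)
qed

lemma optimal_iff_pure:
  assumes G: "joint_uniform G" and feas: "feasible w (x, y, z)" and w: "0 \<le> w" "w \<le> 1"
  shows "optimal w (G, (x, y, z)) \<longleftrightarrow>
    purely_sufficient w (G, (x, y, z)) \<or> purely_sustained w (G, (x, y, z))"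
proof -
  have suff: "purely_sufficient w (G, (x, y, z)) \<longleftrightarrow>
      (x, y, z) = (w, w, 0) \<and> (AE p in G. fst p \<in> {0..w} \<longrightarrow> w \<le> snd p)"
    unfolding purely_sufficient_def is_scheme_def fst_conv snd_conv sufficient_iff[OF G w]
    using G feas by blast
  have sust: "purely_sustained w (G, (x, y, z)) \<longleftrightarrow>
      (x, y, z) = (0, 0, w) \<and> (AE p in G. fst p \<in> {0..w} \<longrightarrow> snd p = w - fst p)"
    unfolding purely_sustained_def is_scheme_def fst_conv snd_conv sustained_iff[OF G w]
    using G feas by blast
  show ?thesis
    unfolding suff sust optimal_iff_performance[OF assms]
  proof
    assume ge: "2 * w \<le> performance (G, (x, y, z))"
    note tight = tight_rules[OF G feas w(2) ge]
    from tight(1) show "(x, y, z) = (w, w, 0) \<and> (AE p in G. fst p \<in> {0..w} \<longrightarrow> w \<le> snd p) \<or>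
        (x, y, z) = (0, 0, w) \<and> (AE p in G. fst p \<in> {0..w} \<longrightarrow> snd p = w - fst p)"
    proof
      assume xyz: "(x, y, z) = (0, 0, w)"
      with sustained_if_tight[OF G w] tight(2) show ?thesis by simp
    next
      assume xyz: "(x, y, z) = (w, w, 0)"
      with sufficient_if_tight[OF G w] tight(2,3) show ?thesis by simp
    qed
  qed (use sufficient_performance[OF G w] sustained_performance[OF G w] in auto)
qed

theorem proposition3:
  fixes w :: real and G :: "(real \<times> real) measure" and x y z :: real
  assumes "joint_uniform G" and "feasible w (x, y, z)"
  shows "(w \<in> {0..1/2} \<longrightarrow>
            (optimal w (G, (x, y, z)) \<longleftrightarrow>
             purely_sufficient w (G, (x, y, z)) \<or> purely_sustained w (G, (x, y, z)))) \<and>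
         (w \<in> {1/2<..1} \<longrightarrow>
            (optimal w (G, (x, y, z)) \<longleftrightarrow> purely_sustained w (G, (x, y, z))))"
proof (intro conjI impI)
  assume "w \<in> {0..1/2}"
  then show "optimal w (G, (x, y, z)) \<longleftrightarrow>
      purely_sufficient w (G, (x, y, z)) \<or> purely_sustained w (G, (x, y, z))"
    by (intro optimal_iff_pure assms) auto
next
  assume w: "w \<in> {1/2<..1}"
  then have "\<not> purely_sufficient w (G, (x, y, z))"
    using no_sufficient_coupling[OF assms(1), of w] sufficient_iff[OF assms(1), of w]
    by (auto simp: purely_sufficient_def)
  then show "optimal w (G, (x, y, z)) \<longleftrightarrow> purely_sustained w (G, (x, y, z))"
    using optimal_iff_pure[OF assms] w by auto
qed

end
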